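(* A Banach space $X$ has property $(\mu^{s})$ if and only if $\mu^{s}(X)=0$.
   Context: Banach spaces are infinite-dimensional, over the real or complex field; $B_X$ denotes the closed unit ball of $X$, and $\mathcal F_X$ the family of all weakly compact subsets of $B_X$. The Mackey topology $\mu(X^*,X)$ on $X^*$ is the topology of uniform convergence on weakly compact subsets of $X$. The family of all subsequences of $(x_n)_{n=1}^\infty$ is denoted $\mathrm{ss}((x_n)_{n=1}^\infty)$. $X$ has property $(\mu^s)$ if every weak$^*$ null sequence in $X^*$ admits a subsequence such that all of its subsequences are Cesàro convergent to $0$ with respect to $\mu(X^*,X)$ (a sequence $(h_n)$ is Cesàro convergent to $0$ if $\frac1n\sum_{i=1}^n h_i\to 0$). For a bounded sequence $(f_n)_{n=1}^\infty$ in $X^*$ define $$\alpha((f_n)_{n=1}^\infty)=\sup_{K\in\mathcal F_X}\limsup_{n\to\infty}\sup_{x\in K}|\langle f_n,x\rangle|,\qquad c\alpha((f_n)_{n=1}^\infty)=\alpha\Big(\Big(\tfrac1n\sum_{i=1}^n f_i\Big)_{n=1}^\infty\Big).$$ Define $$\mu^s(X)=\sup_{(f_n)}\ \inf_{(g_n)\in\mathrm{ss}((f_n))}\ \sup_{(h_n)\in\mathrm{ss}((g_n))}c\alpha((h_n)_{n=1}^\infty),$$ where the first supremum is over all weak$^*$ null sequences $(f_n)_{n=1}^\infty$ in $B_{X^*}$. *)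

theory Defs
  imports "HOL-Analysis.Analysis"
begin

text \<open>
  The scalar field is a type parameter, instantiated with \<open>real\<close> or \<open>complex\<close>.  The class
  \<open>banach\<close> only provides the underlying real Banach space, so multiplication by scalars is an
  explicit parameter \<open>smul\<close>; for real spaces it is \<^term>\<open>scaleR\<close>.
\<close>

locale banach_space_over = vector_space smul
  for smul :: "'k::real_normed_field \<Rightarrow> 'a::banach \<Rightarrow> 'a" +
  assumes norm_smul: "norm (smul c x) = norm c * norm x"
    and smul_of_real: "smul (of_real r) x = r *\<^sub>R x"

lemma banach_space_over_scaleR: "banach_space_over (scaleR :: real \<Rightarrow> 'a::banach \<Rightarrow> 'a)"
  by unfold_locales (auto simp: algebra_simps)

definition infinite_dimensional :: "('k::real_normed_field \<Rightarrow> 'a::banach \<Rightarrow> 'a) \<Rightarrow> bool" where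
  "infinite_dimensional smul \<longleftrightarrow> \<not> (\<exists>B. finite B \<and> module.span smul B = UNIV)"

text \<open>Elements of \<open>'a \<Rightarrow>\<^sub>L 'k\<close> are only real linear; the dual consists of the \<open>'k\<close>-linear ones,
  with the operator norm inherited from \<open>'a \<Rightarrow>\<^sub>L 'k\<close>.\<close>

definition dual :: "('k::real_normed_field \<Rightarrow> 'a::banach \<Rightarrow> 'a) \<Rightarrow> ('a \<Rightarrow>\<^sub>L 'k) set" where
  "dual smul = {f. \<forall>c x. blinfun_apply f (smul c x) = c * blinfun_apply f x}"

definition weak_topology :: "('k::real_normed_field \<Rightarrow> 'a::banach \<Rightarrow> 'a) \<Rightarrow> 'a topology" where
  "weak_topology smul =
     topology_generated_by {blinfun_apply f -` U |f U. f \<in> dual smul \<and> open U}"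

definition weakly_compact :: "('k::real_normed_field \<Rightarrow> 'a::banach \<Rightarrow> 'a) \<Rightarrow> 'a set \<Rightarrow> bool" where
  "weakly_compact smul K \<longleftrightarrow> compactin (weak_topology smul) K"

text \<open>The strong operator topology on \<open>'a \<Rightarrow>\<^sub>L 'k\<close> is the topology of pointwise convergence.\<close>

definition weak_star_topology ::
    "('k::real_normed_field \<Rightarrow> 'a::banach \<Rightarrow> 'a) \<Rightarrow> ('a \<Rightarrow>\<^sub>L 'k) topology" where
  "weak_star_topology smul = subtopology strong_operator_topology (dual smul)"

definition weak_star_null ::
    "('k::real_normed_field \<Rightarrow> 'a::banach \<Rightarrow> 'a) \<Rightarrow> (nat \<Rightarrow> 'a \<Rightarrow>\<^sub>L 'k) \<Rightarrow> bool" where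
  "weak_star_null smul f \<longleftrightarrow>
     range f \<subseteq> dual smul \<and> limitin (weak_star_topology smul) f 0 sequentially"

text \<open>Uniform convergence on weakly compact sets.  A single \<open>K\<close> suffices for basic
  neighbourhoods, as finite unions of weakly compact sets are weakly compact.\<close>

definition mackey_open ::
    "('k::real_normed_field \<Rightarrow> 'a::banach \<Rightarrow> 'a) \<Rightarrow> ('a \<Rightarrow>\<^sub>L 'k) set \<Rightarrow> bool" where
  "mackey_open smul U \<longleftrightarrow> U \<subseteq> dual smul \<and>
     (\<forall>f\<in>U. \<exists>K \<epsilon>. weakly_compact smul K \<and> \<epsilon> > 0 \<and>
        {g \<in> dual smul. \<forall>x\<in>K. norm (blinfun_apply g x - blinfun_apply f x) < \<epsilon>} \<subseteq> U)"

definition mackey_topology ::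
    "('k::real_normed_field \<Rightarrow> 'a::banach \<Rightarrow> 'a) \<Rightarrow> ('a \<Rightarrow>\<^sub>L 'k) topology" where
  "mackey_topology smul = topology (mackey_open smul)"

lemma istopology_mackey_open: "istopology (mackey_open smul)"
  unfolding istopology_def
proof (intro conjI allI impI)
  fix S T assume S: "mackey_open smul S" and T: "mackey_open smul T"
  show "mackey_open smul (S \<inter> T)"
    unfolding mackey_open_def
  proof (intro conjI ballI)
    show "S \<inter> T \<subseteq> dual smul"
      using S by (auto simp: mackey_open_def)
    fix f assume f: "f \<in> S \<inter> T"
    obtain K d where K: "weakly_compact smul K" "d > 0"
      "{g \<in> dual smul. \<forall>x\<in>K. norm (blinfun_apply g x - blinfun_apply f x) < d} \<subseteq> S"
      using S f unfolding mackey_open_def by blast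
    obtain L e where L: "weakly_compact smul L" "e > 0"
      "{g \<in> dual smul. \<forall>x\<in>L. norm (blinfun_apply g x - blinfun_apply f x) < e} \<subseteq> T"
      using T f unfolding mackey_open_def by blast
    have "weakly_compact smul (K \<union> L)"
      using K(1) L(1) unfolding weakly_compact_def by (rule compactin_Un)
    moreover have "min d e > 0"
      using K(2) L(2) by simp
    moreover have "{g \<in> dual smul. \<forall>x\<in>K \<union> L.
        norm (blinfun_apply g x - blinfun_apply f x) < min d e} \<subseteq> S \<inter> T"
      using K(3) L(3) by auto
    ultimately show "\<exists>K \<epsilon>. weakly_compact smul K \<and> \<epsilon> > 0 \<and>
        {g \<in> dual smul. \<forall>x\<in>K. norm (blinfun_apply g x - blinfun_apply f x) < \<epsilon>} \<subseteq> S \<inter> T"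
      by blast
  qed
next
  fix \<U> assume U: "\<forall>S\<in>\<U>. mackey_open smul S"
  show "mackey_open smul (\<Union>\<U>)"
    unfolding mackey_open_def
  proof (intro conjI ballI)
    show "\<Union>\<U> \<subseteq> dual smul"
      using U by (auto simp: mackey_open_def)
    fix f assume "f \<in> \<Union>\<U>"
    then obtain S where S: "S \<in> \<U>" "f \<in> S" by blast
    then obtain K e where K: "weakly_compact smul K" "e > 0"
      "{g \<in> dual smul. \<forall>x\<in>K. norm (blinfun_apply g x - blinfun_apply f x) < e} \<subseteq> S"
      using U unfolding mackey_open_def by blast
    have "{g \<in> dual smul. \<forall>x\<in>K. norm (blinfun_apply g x - blinfun_apply f x) < e} \<subseteq> \<Union>\<U>"
      using K(3) S(1) by blast
    then show "\<exists>K \<epsilon>. weakly_compact smul K \<and> \<epsilon> > 0 \<and>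
        {g \<in> dual smul. \<forall>x\<in>K. norm (blinfun_apply g x - blinfun_apply f x) < \<epsilon>} \<subseteq> \<Union>\<U>"
      using K(1,2) by blast
  qed
qed

lemma openin_mackey_topology: "openin (mackey_topology smul) U \<longleftrightarrow> mackey_open smul U"
  by (simp add: mackey_topology_def topology_inverse' istopology_mackey_open)

definition subsequences :: "(nat \<Rightarrow> 'b) \<Rightarrow> (nat \<Rightarrow> 'b) set" where
  "subsequences f = {f \<circ> r |r. strict_mono r}"

text \<open>Sequences are indexed from \<open>0\<close>, so the mean with index \<open>n\<close> has \<open>n + 1\<close> terms.\<close>

definition cesaro :: "(nat \<Rightarrow> 'b::real_vector) \<Rightarrow> nat \<Rightarrow> 'b" where
  "cesaro f n = (\<Sum>i\<le>n. f i) /\<^sub>R real (Suc n)"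

definition property_mu_s :: "('k::real_normed_field \<Rightarrow> 'a::banach \<Rightarrow> 'a) \<Rightarrow> bool" where
  "property_mu_s smul \<longleftrightarrow>
     (\<forall>f. weak_star_null smul f \<longrightarrow>
        (\<exists>g \<in> subsequences f. \<forall>h \<in> subsequences g.
           limitin (mackey_topology smul) (cesaro h) 0 sequentially))"

text \<open>Suprema are taken in \<^typ>\<open>ennreal\<close>, where the supremum of the empty set is \<open>0\<close>.\<close>

definition alpha ::
    "('k::real_normed_field \<Rightarrow> 'a::banach \<Rightarrow> 'a) \<Rightarrow> (nat \<Rightarrow> 'a \<Rightarrow>\<^sub>L 'k) \<Rightarrow> ennreal" where
  "alpha smul f =
     (SUP K \<in> {K. K \<subseteq> cball 0 1 \<and> weakly_compact smul K}.
        limsup (\<lambda>n. SUP x\<in>K. ennreal (norm (blinfun_apply (f n) x))))"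

definition c_alpha ::
    "('k::real_normed_field \<Rightarrow> 'a::banach \<Rightarrow> 'a) \<Rightarrow> (nat \<Rightarrow> 'a \<Rightarrow>\<^sub>L 'k) \<Rightarrow> ennreal" where
  "c_alpha smul f = alpha smul (cesaro f)"

definition mu_s :: "('k::real_normed_field \<Rightarrow> 'a::banach \<Rightarrow> 'a) \<Rightarrow> ennreal" where
  "mu_s smul =
     (SUP f \<in> {f. weak_star_null smul f \<and> (\<forall>n. norm (f n) \<le> 1)}.
        INF g \<in> subsequences f. SUP h \<in> subsequences g. c_alpha smul h)"

end

theory Submission
  imports Defs "HOL-Library.Diagonal_Subsequence"
begin

text \<open>
  If \<open>\<mu>\<^sup>s(X) = 0\<close>, the infimum over subsequences is only known to be zero, so successive
  subsequences with \<open>c\<alpha> < 1/k\<close> along all further subsequences are combined into a diagonal one;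
  changing finitely many terms of a bounded sequence does not affect the limiting behaviour of its
  Cesaro means.  Scaling then removes the two normalisations in \<open>\<mu>\<^sup>s\<close>: weak* null sequences are
  bounded by the uniform boundedness principle, and so are weakly compact sets, seen as pointwise
  bounded families of functionals on the real dual, which is norming by Hahn-Banach.
\<close>

subsection \<open>Uniform boundedness\<close>

text \<open>Baire category: the closed sets \<open>A n\<close>, where the family is bounded by
  \<open>n\<close>, cover the Banach space, so one of them contains a ball, and a bound on a ball
  becomes a bound on operator norms.\<close>

theorem uniform_boundedness:
  fixes T :: "'i \<Rightarrow> 'a::banach \<Rightarrow>\<^sub>L 'b::real_normed_vector"
  assumes pt: "\<And>x. \<exists>C. \<forall>i\<in>I. norm (T i x) \<le> C"
  obtains C where "C > 0" "\<And>i. i \<in> I \<Longrightarrow> norm (T i) \<le> C"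
proof -
  define A where "A n = {x. \<forall>i\<in>I. norm (T i x) \<le> real n}" for n
  have cl: "closed (A n)" for n
  proof -
    have "A n = (\<Inter>i\<in>I. {x. norm (T i x) \<le> real n})"
      by (auto simp: A_def)
    moreover have "closed {x. norm (T i x) \<le> real n}" for i
      by (intro closed_Collect_le continuous_intros)
    ultimately show ?thesis by auto
  qed
  have un: "(\<Union>n. A n) = UNIV"
  proof -
    have "\<exists>n. x \<in> A n" for x
    proof -
      obtain C where C: "\<forall>i\<in>I. norm (T i x) \<le> C" using pt by blast
      obtain n where "C \<le> real n" using real_arch_simple by blast
      then have "x \<in> A n" using C by (force simp: A_def)
      then show ?thesis by blast
    qed
    then show ?thesis by blast
  qed
  have "\<exists>n. interior (A n) \<noteq> {}"
  proof (rule ccontr)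
    assume *: "\<not> ?thesis"
    have "(euclidean::'a topology) interior_of \<Union>(range A) = {}"
    proof (rule Baire_category_alt)
      show "completely_metrizable_space (euclidean::'a topology) \<or>
        locally_compact_space (euclidean::'a topology) \<and> regular_space (euclidean::'a topology)"
        using completely_metrizable_space_euclidean by blast
    qed (use * cl in auto)
    then show False using un by simp
  qed
  then obtain n x where "x \<in> interior (A n)" by blast
  then obtain e where e: "e > 0" "cball x e \<subseteq> A n"
    by (meson mem_interior_cball)
  have "norm (T i) \<le> 2 * real n / e" if i: "i \<in> I" for i
  proof (rule norm_blinfun_bound)
    show "0 \<le> 2 * real n / e" using e by simp
    fix y :: 'a
    show "norm (T i y) \<le> 2 * real n / e * norm y"
    proof (cases "y = 0")
      case False
      \<comment> \<open>This \<open>c\<close> moves \<open>x\<close> by exactly \<open>e\<close>, so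
        \<open>x\<close> and its translate both lie in the ball; subtracting their images costs
        twice the bound \<open>real n\<close>.\<close>
      define c where "c = e / norm y"
      have c: "c > 0" using e False by (simp add: c_def)
      have "x + c *\<^sub>R y \<in> cball x e" "x \<in> cball x e"
        using e False by (auto simp: dist_norm c_def)
      then have "x + c *\<^sub>R y \<in> A n" "x \<in> A n"
        using e(2) by blast+
      then have "norm (T i (x + c *\<^sub>R y)) \<le> real n" "norm (T i x) \<le> real n"
        using i by (auto simp: A_def)
      moreover have "c *\<^sub>R T i y = T i (x + c *\<^sub>R y) - T i x"
        by (simp add: blinfun.bilinear_simps)
      ultimately have "norm (c *\<^sub>R T i y) \<le> 2 * real n"
        using norm_triangle_ineq4[of "T i (x + c *\<^sub>R y)" "T i x"] by simp
      then have "c * norm (T i y) \<le> 2 * real n" using c by simp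
      then show ?thesis using False e by (simp add: c_def field_simps)
    qed simp
  qed
  \<comment> \<open>The maximum with 1 keeps the constant positive even for
    \<open>n = 0\<close>.\<close>
  then have "norm (T i) \<le> max 1 (2 * real n / e)" if "i \<in> I" for i
    using that by fastforce
  then show ?thesis using that[of "max 1 (2 * real n / e)"] by simp
qed

subsection \<open>Norming functionals\<close>

definition sublinear :: "('a::real_vector \<Rightarrow> real) \<Rightarrow> bool" where
  "sublinear p \<longleftrightarrow> (\<forall>x y. p (x + y) \<le> p x + p y) \<and> (\<forall>c x. c > 0 \<longrightarrow> p (c *\<^sub>R x) = c * p x)"

text \<open>Equality in positive homogeneity comes from using the inequality a second time, at
  \<open>c *\<^sub>R x\<close> with factor \<open>1 / c\<close>.\<close>

lemma sublinearI:
  assumes "\<And>x y. p (x + y) \<le> p x + p y" "\<And>c x. c > 0 \<Longrightarrow> p (c *\<^sub>R x) \<le> c * p x"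
  shows "sublinear p"
  unfolding sublinear_def
proof (intro conjI allI impI assms(1))
  fix c :: real and x assume c: "c > 0"
  have "p x \<le> p (c *\<^sub>R x) / c"
    using assms(2)[of "1 / c" "c *\<^sub>R x"] c by simp
  then show "p (c *\<^sub>R x) = c * p x"
    using assms(2)[OF c, of x] c by (simp add: field_simps)
qed

lemma sublinear_0: "sublinear p \<Longrightarrow> p 0 = 0"
  unfolding sublinear_def
  by (metis scaleR_zero_right mult_cancel_right1 zero_less_numeral numeral_eq_one_iff semiring_norm(85))

lemma sublinear_minus: "sublinear p \<Longrightarrow> - p (- x) \<le> p x"
  using sublinear_0[of p] unfolding sublinear_def by (smt (verit) add.right_inverse)

lemma sublinear_scaleR: "sublinear p \<Longrightarrow> c \<ge> 0 \<Longrightarrow> p (c *\<^sub>R x) = c * p x"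
  using sublinear_0[of p] by (cases "c = 0") (auto simp: sublinear_def)

text \<open>Lowers \<open>p\<close> as far as sublinearity permits when its value at \<open>- y\<close> is forced down to \<open>- p y\<close>;
  a minimal sublinear functional is therefore fixed by this operation, hence linear.\<close>

definition lower :: "('a::real_vector \<Rightarrow> real) \<Rightarrow> 'a \<Rightarrow> 'a \<Rightarrow> real" where
  "lower p y x = (INF t\<in>{0..}. p (x + t *\<^sub>R y) - t * p y)"

text \<open>The point is that the infimum is taken over a set bounded below: by subadditivity every
  term is at least \<open>- p (- x)\<close>, whatever the shift.\<close>

lemma lower_le_shift:
  assumes p: "sublinear p" and t: "t \<ge> 0"
  shows "lower p y x \<le> p (x + t *\<^sub>R y) - t * p y"
  unfolding lower_def
proof (rule cINF_lower)
  have "- p (- x) \<le> p (x + s *\<^sub>R y) - s * p y" if "s \<ge> 0" for s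
  proof -
    have "p (s *\<^sub>R y) \<le> p (x + s *\<^sub>R y) + p (- x)"
      using p unfolding sublinear_def
      by (metis add.commute add_minus_cancel)
    then show ?thesis using sublinear_scaleR[OF p that] by simp
  qed
  then show "bdd_below ((\<lambda>t. p (x + t *\<^sub>R y) - t * p y) ` {0..})"
    by (intro bdd_belowI2[of _ "- p (- x)"]) simp
qed (use t in simp)

lemma lower_greatest:
  assumes "\<And>t. t \<ge> 0 \<Longrightarrow> m \<le> p (x + t *\<^sub>R y) - t * p y"
  shows "m \<le> lower p y x"
  unfolding lower_def by (rule cINF_greatest) (use assms in auto)

lemma lower_le:
  assumes "sublinear p"
  shows "lower p y x \<le> p x"
  using lower_le_shift[OF assms, of 0 y x] by simp

text \<open>Shifts \<open>s\<close> for \<open>u\<close> and \<open>t\<close> for \<open>v\<close>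
  combine to the shift \<open>s + t\<close> for \<open>u + v\<close>; a shift \<open>t\<close> for
  \<open>x\<close> becomes the shift \<open>c * t\<close> for \<open>c *\<^sub>R x\<close>.\<close>

lemma sublinear_lower:
  assumes p: "sublinear p"
  shows "sublinear (lower p y)"
proof (rule sublinearI)
  fix u v
  have "lower p y (u + v) - (p (u + s *\<^sub>R y) - s * p y) \<le> p (v + t *\<^sub>R y) - t * p y"
    if "s \<ge> 0" "t \<ge> 0" for s t
  proof -
    have "lower p y (u + v) \<le> p ((u + v) + (s + t) *\<^sub>R y) - (s + t) * p y"
      by (rule lower_le_shift) (use p that in auto)
    moreover have "(u + v) + (s + t) *\<^sub>R y = (u + s *\<^sub>R y) + (v + t *\<^sub>R y)"
      by (simp add: algebra_simps)
    ultimately show ?thesis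
      using p unfolding sublinear_def by (smt (verit) distrib_right)
  qed
  then have "lower p y (u + v) - (p (u + s *\<^sub>R y) - s * p y) \<le> lower p y v" if "s \<ge> 0" for s
    using that by (intro lower_greatest)
  then have "lower p y (u + v) - lower p y v \<le> p (u + s *\<^sub>R y) - s * p y" if "s \<ge> 0" for s
    using that by (smt (verit))
  then have "lower p y (u + v) - lower p y v \<le> lower p y u"
    by (intro lower_greatest)
  then show "lower p y (u + v) \<le> lower p y u + lower p y v" by simp
next
  fix c :: real and x assume c: "c > 0"
  have "lower p y (c *\<^sub>R x) / c \<le> p (x + t *\<^sub>R y) - t * p y" if t: "t \<ge> 0" for t
  proof -
    have "lower p y (c *\<^sub>R x) \<le> p (c *\<^sub>R x + (c * t) *\<^sub>R y) - (c * t) * p y"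
      by (rule lower_le_shift) (use p c t in auto)
    also have "c *\<^sub>R x + (c * t) *\<^sub>R y = c *\<^sub>R (x + t *\<^sub>R y)"
      by (simp add: algebra_simps)
    also have "p \<dots> = c * p (x + t *\<^sub>R y)"
      using p c by (simp add: sublinear_def)
    finally show ?thesis using c by (simp add: field_simps)
  qed
  then have "lower p y (c *\<^sub>R x) / c \<le> lower p y x" by (intro lower_greatest)
  then show "lower p y (c *\<^sub>R x) \<le> c * lower p y x" using c by (simp add: field_simps)
qed

text \<open>Zorn's lemma for the reversed pointwise order. A chain is bounded below by its pointwise
  infimum, which is finite because every member stays above \<open>- p (- x)\<close>.\<close>

lemma minimal_sublinear:
  assumes p: "sublinear p"
  obtains q where "sublinear q" "q \<le> p" "\<And>r. sublinear r \<Longrightarrow> r \<le> q \<Longrightarrow> r = q"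
proof -
  define A where "A = {q. sublinear q \<and> q \<le> p}"
  have "\<exists>m\<in>A. \<forall>a\<in>A. m \<ge> a \<longrightarrow> a = m"
  proof (rule predicate_Zorn)
    show "partial_order_on A (relation_of (\<ge>) A)"
      by (rule partial_order_on_relation_ofI) auto
    fix C assume C: "C \<in> Chains (relation_of (\<ge>) A)"
    have CA: "C \<subseteq> A" and ch: "\<And>a b. a \<in> C \<Longrightarrow> b \<in> C \<Longrightarrow> a \<le> b \<or> b \<le> a"
      using C by (auto simp: Chains_def relation_of_def)
    show "\<exists>u\<in>A. \<forall>a\<in>C. a \<ge> u"
    proof (cases "C = {}")
      case True
      then show ?thesis using p by (auto simp: A_def)
    next
      case ne: False
      define u where "u x = (INF q\<in>C. q x)" for x
      have bdd: "bdd_below ((\<lambda>q. q x) ` C)" for x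
      proof (rule bdd_belowI2)
        fix q assume "q \<in> C"
        then have "sublinear q" "q (- x) \<le> p (- x)"
          using CA by (auto simp: A_def le_fun_def)
        then show "- p (- x) \<le> q x" using sublinear_minus[of q x] by linarith
      qed
      have ule: "u x \<le> q x" if "q \<in> C" for q x
        unfolding u_def by (rule cINF_lower[OF bdd that])
      have ugr: "m \<le> u x" if "\<And>q. q \<in> C \<Longrightarrow> m \<le> q x" for m x
        unfolding u_def by (rule cINF_greatest[OF ne that])
      have "sublinear u"
      proof (rule sublinearI)
        fix x y
        have *: "u (x + y) \<le> q x + r y" if qr: "q \<in> C" "r \<in> C" for q r
        proof -
          \<comment> \<open>Comparability in the chain gives one member below both \<open>q\<close>
            and \<open>r\<close>; this makes the pointwise infimum subadditive.\<close>
          obtain s where s: "s \<in> C" "s \<le> q" "s \<le> r" using ch[OF qr] qr order_refl by metis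
          then have "s (x + y) \<le> s x + s y" using CA by (auto simp: A_def sublinear_def)
          then show ?thesis using s ule[of s "x + y"] by (smt (verit) le_fun_def)
        qed
        have "u (x + y) - q x \<le> u y" if "q \<in> C" for q
          by (rule ugr) (use *[OF that] in \<open>simp add: algebra_simps\<close>)
        then have "u (x + y) - u y \<le> u x"
          by (intro ugr) (simp add: algebra_simps)
        then show "u (x + y) \<le> u x + u y" by simp
      next
        fix c :: real and x assume c: "c > 0"
        have "u (c *\<^sub>R x) / c \<le> u x"
        proof (rule ugr)
          fix q assume q: "q \<in> C"
          then have "q (c *\<^sub>R x) = c * q x" using CA c by (auto simp: A_def sublinear_def)
          then show "u (c *\<^sub>R x) / c \<le> q x" using ule[OF q, of "c *\<^sub>R x"] c by (simp add: field_simps)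
        qed
        then show "u (c *\<^sub>R x) \<le> c * u x" using c by (simp add: field_simps)
      qed
      moreover have "u \<le> p"
      proof (rule le_funI)
        fix x
        obtain q where q: "q \<in> C" using ne by blast
        then have "q x \<le> p x" using CA by (auto simp: A_def le_fun_def)
        then show "u x \<le> p x" using ule[OF q, of x] by simp
      qed
      ultimately show ?thesis using ule by (auto simp: A_def le_fun_def)
    qed
  qed
  then obtain m where m: "m \<in> A" "\<And>a. a \<in> A \<Longrightarrow> a \<le> m \<Longrightarrow> a = m" by blast
  show ?thesis
  proof
    show "sublinear m" "m \<le> p" using m(1) by (auto simp: A_def)
    show "r = m" if "sublinear r" "r \<le> m" for r
      using that m order_trans[of r m p] by (auto simp: A_def)
  qed
qed

text \<open>Minimality gives \<open>lower q y = q\<close>, and the shift by 1 then reads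
  \<open>q x \<le> q (x + y) - q y\<close>, the missing half of additivity.\<close>

lemma minimal_sublinear_linear:
  assumes q: "sublinear q" and min: "\<And>r. sublinear r \<Longrightarrow> r \<le> q \<Longrightarrow> r = q"
  shows "linear q"
proof -
  have low: "lower q y = q" for y
    by (intro min sublinear_lower le_funI lower_le q)
  have add: "q (x + y) = q x + q y" for x y
  proof (rule antisym)
    show "q (x + y) \<le> q x + q y" using q by (simp add: sublinear_def)
    show "q x + q y \<le> q (x + y)" using lower_le_shift[OF q, of 1 y x] by (simp add: low)
  qed
  have neg: "q (- x) = - q x" for x
    using add[of x "- x"] sublinear_0[OF q] by simp
  have "q (c *\<^sub>R x) = c * q x" for c x
  proof (cases "c \<ge> 0")
    case True
    then show ?thesis using q by (rule sublinear_scaleR[rotated])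
  next
    case False
    then have "q ((- c) *\<^sub>R x) = (- c) * q x" using sublinear_scaleR[OF q, of "- c"] by simp
    then show ?thesis using neg[of "c *\<^sub>R x"] by simp
  qed
  then show ?thesis by (intro linearI) (auto simp: add)
qed

text \<open>Instead of extending a functional from the line through \<open>z\<close>, a minimal
  sublinear functional is taken below \<open>lower norm z\<close>, which already has the right value
  at \<open>- z\<close>.\<close>

theorem norming_functional:
  fixes z :: "'a::real_normed_vector"
  obtains u :: "'a \<Rightarrow>\<^sub>L real" where "norm u \<le> 1" "u z = norm z"
proof -
  have n: "sublinear (norm :: 'a \<Rightarrow> real)"
    by (rule sublinearI) (auto intro: norm_triangle_ineq)
  obtain q where q: "sublinear q" "q \<le> lower norm z"
      and min: "\<And>r. sublinear r \<Longrightarrow> r \<le> q \<Longrightarrow> r = q"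
    using minimal_sublinear[OF sublinear_lower[OF n]] by blast
  have lin: "linear q" using minimal_sublinear_linear[OF q(1) min] .
  have le: "q x \<le> norm x" for x
    using le_funD[OF q(2), of x] lower_le[OF n, of z x] by linarith
  have ab: "\<bar>q x\<bar> \<le> norm x" for x
    using le[of x] le[of "- x"] linear_neg[OF lin, of x] by simp
  have bl: "bounded_linear q"
    by (intro bounded_linear_intro[of q 1]) (use lin ab in \<open>auto simp: linear_add linear_scale\<close>)
  \<comment> \<open>The shift by 1 sends \<open>- z\<close> to the origin, leaving the bound
    \<open>norm 0 - norm z\<close>.\<close>
  have "q (- z) \<le> - norm z"
    using le_funD[OF q(2), of "- z"] lower_le_shift[OF n, of 1 z "- z"] by simp
  then have "q z = norm z" using le[of z] linear_neg[OF lin, of z] by simp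
  moreover have "norm (Blinfun q) \<le> 1"
    by (rule norm_blinfun_bound) (use ab in \<open>auto simp: bounded_linear_Blinfun_apply[OF bl]\<close>)
  ultimately show ?thesis
    using that[of "Blinfun q"] by (simp add: bounded_linear_Blinfun_apply[OF bl])
qed

text \<open>Points of \<open>K\<close> act as evaluation functionals on the real dual, a Banach
  space, so uniform boundedness applies there; a norming functional turns the bound on
  \<open>T x\<close> into one on \<open>x\<close>.\<close>

theorem weakly_bounded_imp_bounded:
  fixes K :: "'a::real_normed_vector set"
  assumes "\<And>u :: 'a \<Rightarrow>\<^sub>L real. \<exists>C. \<forall>x\<in>K. \<bar>u x\<bar> \<le> C"
  obtains C where "C > 0" "\<And>x. x \<in> K \<Longrightarrow> norm x \<le> C"
proof -
  define T :: "'a \<Rightarrow> ('a \<Rightarrow>\<^sub>L real) \<Rightarrow>\<^sub>L real" where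
    "T x = Blinfun (\<lambda>u. blinfun_apply u x)" for x
  have T: "T x u = u x" for x u
    unfolding T_def by (subst bounded_linear_Blinfun_apply) (auto intro: blinfun.bounded_linear_left)
  obtain C where C: "C > 0" "\<And>x. x \<in> K \<Longrightarrow> norm (T x) \<le> C"
    using uniform_boundedness[of K T] assms by (auto simp: T)
  have "norm x \<le> C" if "x \<in> K" for x
  proof -
    obtain u :: "'a \<Rightarrow>\<^sub>L real" where u: "norm u \<le> 1" "u x = norm x"
      by (rule norming_functional)
    have "norm x = norm (T x u)" by (simp add: T u)
    also have "\<dots> \<le> norm (T x) * norm u" by (rule norm_blinfun)
    also have "\<dots> \<le> C * 1" using C that u by (intro mult_mono) auto
    finally show ?thesis by simp
  qed
  then show ?thesis using that C(1) by blast
qed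

subsection \<open>The weak, weak* and Mackey topologies\<close>

text \<open>The topology is pulled back from a product topology, where convergence is
  coordinatewise.\<close>

lemma limitin_strong_operator_topology_iff:
  "limitin strong_operator_topology f l F \<longleftrightarrow> (\<forall>x. ((\<lambda>n. blinfun_apply (f n) x) \<longlongrightarrow> l x) F)"
proof
  assume "limitin strong_operator_topology f l F"
  then have "limitin euclidean ((\<lambda>g. blinfun_apply g x) \<circ> f) (l x) F" for x
    by (rule continuous_map_limit[OF strong_operator_topology_continuous_evaluation])
  then show "\<forall>x. ((\<lambda>n. blinfun_apply (f n) x) \<longlongrightarrow> l x) F"
    by (simp add: o_def)
next
  assume "\<forall>x. ((\<lambda>n. blinfun_apply (f n) x) \<longlongrightarrow> l x) F"
  then have "limitin (product_topology (\<lambda>x. euclidean) UNIV) (\<lambda>n. blinfun_apply (f n)) (blinfun_apply l) F"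
    by (auto simp: limitin_componentwise)
  then have lim: "((\<lambda>n. blinfun_apply (f n)) \<longlongrightarrow> blinfun_apply l) F"
    by (simp add: euclidean_product_topology)
  show "limitin strong_operator_topology f l F"
    unfolding limitin_def
  proof (intro conjI allI impI)
    fix U assume U: "openin strong_operator_topology U \<and> l \<in> U"
    then obtain V where "open V" "U = blinfun_apply -` V"
      unfolding strong_operator_topology_def by (auto simp: openin_pullback_topology)
    then show "eventually (\<lambda>n. f n \<in> U) F"
      using U topological_tendstoD[OF lim, of V] by simp
  qed (simp add: strong_operator_topology_topspace)
qed

lemma dual_zero [simp]: "0 \<in> dual smul"
  by (simp add: dual_def)

lemma dual_scaleR [intro]: "f \<in> dual smul \<Longrightarrow> r *\<^sub>R f \<in> dual smul"
  by (simp add: dual_def blinfun.bilinear_simps)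

lemma dual_add [intro]: "f \<in> dual smul \<Longrightarrow> g \<in> dual smul \<Longrightarrow> f + g \<in> dual smul"
  by (simp add: dual_def blinfun.bilinear_simps algebra_simps)

lemma dual_cesaro [intro]: "(\<And>n. f n \<in> dual smul) \<Longrightarrow> cesaro f n \<in> dual smul"
proof -
  assume f: "\<And>n. f n \<in> dual smul"
  have "(\<Sum>i\<le>n. f i) \<in> dual smul"
    by (induction n) (use f in auto)
  then show ?thesis by (auto simp: cesaro_def)
qed

lemma weak_star_null_iff:
  "weak_star_null smul f \<longleftrightarrow> range f \<subseteq> dual smul \<and> (\<forall>x. (\<lambda>n. blinfun_apply (f n) x) \<longlonglongrightarrow> 0)"
  by (auto simp: weak_star_null_def weak_star_topology_def limitin_subtopology
      limitin_strong_operator_topology_iff intro!: always_eventually)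

lemma weak_star_null_scaleR:
  assumes "weak_star_null smul f"
  shows "weak_star_null smul (\<lambda>n. r *\<^sub>R f n)"
  using assms tendsto_scaleR[OF tendsto_const, of _ 0 sequentially r]
  by (auto simp: weak_star_null_iff blinfun.bilinear_simps)

lemma weak_star_null_subseq:
  assumes "weak_star_null smul f" "strict_mono r"
  shows "weak_star_null smul (f \<circ> r)"
  using assms LIMSEQ_subseq_LIMSEQ[of "\<lambda>n. blinfun_apply (f n) _" 0 r]
  by (auto simp: weak_star_null_iff o_def)

text \<open>Convergent sequences of scalars are bounded, so uniform boundedness applies; this
  permits normalising a weak* null sequence.\<close>

lemma weak_star_null_bounded:
  assumes "weak_star_null smul f"
  obtains M where "M > 0" "\<And>n. norm (f n) \<le> M"
proof -
  have "Bseq (\<lambda>n. f n x)" for x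
    using assms by (auto simp: weak_star_null_iff intro!: convergent_imp_Bseq convergentI)
  then have "\<exists>C. \<forall>n\<in>UNIV. norm (f n x) \<le> C" for x
    by (auto simp: Bseq_def)
  then show ?thesis using uniform_boundedness[of UNIV f] that by (metis UNIV_I)
qed

lemma limitin_mackey_topology_0_iff:
  assumes h: "\<And>n. h n \<in> dual smul"
  shows "limitin (mackey_topology smul) h 0 F \<longleftrightarrow>
    (\<forall>K e. weakly_compact smul K \<longrightarrow> e > 0 \<longrightarrow> (\<forall>\<^sub>F n in F. \<forall>x\<in>K. norm (h n x) < e))"
proof (intro iffI allI impI)
  fix K and e :: real
  assume lim: "limitin (mackey_topology smul) h 0 F" and K: "weakly_compact smul K" and e: "e > 0"
  \<comment> \<open>The bound \<open>d\<close> is uniform on \<open>K\<close> and strictly below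
    \<open>e\<close>. Half the gap \<open>e - d\<close> is then room for a perturbation, so
    \<open>U\<close> is open without knowing that suprema over \<open>K\<close> are
    attained.\<close>
  define U where "U = {f \<in> dual smul. \<exists>d<e. \<forall>x\<in>K. norm (f x) \<le> d}"
  have "mackey_open smul U"
    unfolding mackey_open_def
  proof (intro conjI ballI)
    show "U \<subseteq> dual smul" by (auto simp: U_def)
    fix f assume "f \<in> U"
    then obtain d where d: "d < e" "\<forall>x\<in>K. norm (f x) \<le> d" by (auto simp: U_def)
    have "g \<in> U" if g: "g \<in> dual smul" "\<forall>x\<in>K. norm (g x - f x) < (e - d) / 2" for g
    proof -
      have "norm (g x) \<le> (e + d) / 2" if "x \<in> K" for x
      proof -
        have "norm (g x) \<le> norm (g x - f x) + norm (f x)"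
          using norm_triangle_ineq[of "g x - f x" "f x"] by simp
        then show ?thesis using g(2) d(2) that by (smt (verit) field_sum_of_halves add_divide_distrib diff_divide_distrib)
      qed
      then show ?thesis using g(1) d(1) by (auto simp: U_def intro!: exI[of _ "(e + d) / 2"])
    qed
    then show "\<exists>K \<epsilon>. weakly_compact smul K \<and> \<epsilon> > 0 \<and>
        {g \<in> dual smul. \<forall>x\<in>K. norm (g x - f x) < \<epsilon>} \<subseteq> U"
      using K d(1) by (intro exI[of _ K] exI[of _ "(e - d) / 2"]) auto
  qed
  moreover have "0 \<in> U" using e by (auto simp: U_def)
  ultimately have "\<forall>\<^sub>F n in F. h n \<in> U"
    using lim by (auto simp: limitin_def openin_mackey_topology)
  then show "\<forall>\<^sub>F n in F. \<forall>x\<in>K. norm (h n x) < e"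
    by eventually_elim (auto simp: U_def)
next
  assume *: "\<forall>K e. weakly_compact smul K \<longrightarrow> e > 0 \<longrightarrow> (\<forall>\<^sub>F n in F. \<forall>x\<in>K. norm (h n x) < e)"
  show "limitin (mackey_topology smul) h 0 F"
    unfolding limitin_def
  proof (intro conjI allI impI)
    \<comment> \<open>For \<open>K = {}\<close> the basic neighbourhood is the whole dual.\<close>
    have "mackey_open smul (dual smul)"
      by (auto simp: mackey_open_def weakly_compact_def intro!: exI[of _ "{}"] exI[of _ 1])
    then show "0 \<in> topspace (mackey_topology smul)"
      unfolding topspace_def openin_mackey_topology using dual_zero by blast
    fix U assume "openin (mackey_topology smul) U \<and> 0 \<in> U"
    then obtain K e where K: "weakly_compact smul K" "e > 0"
        "{g \<in> dual smul. \<forall>x\<in>K. norm (g x - blinfun_apply 0 x) < e} \<subseteq> U"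
      unfolding openin_mackey_topology mackey_open_def by blast
    have "\<forall>\<^sub>F n in F. \<forall>x\<in>K. norm (h n x) < e" using * K by blast
    then show "\<forall>\<^sub>F n in F. h n \<in> U"
      by eventually_elim (use K(3) h in auto)
  qed
qed

section \<open>Scaling and boundedness of weakly compact sets\<close>

text \<open>Scaling is weakly continuous because composing \<open>f\<close> with it gives
  \<open>r *\<^sub>R f\<close>, again in the dual.\<close>

lemma (in banach_space_over) weakly_compact_scaleR:
  assumes "weakly_compact smul K"
  shows "weakly_compact smul ((\<lambda>x. r *\<^sub>R x) ` K)"
proof -
  let ?B = "{blinfun_apply f -` U |f U. f \<in> dual smul \<and> open U}"
  \<comment> \<open>The zero functional shows that the generating sets cover the whole
    space.\<close>
  have "UNIV \<in> ?B"
    by (rule CollectI, rule exI[of _ 0], rule exI[of _ UNIV]) auto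
  then have top: "\<Union>?B = UNIV" by blast
  have "continuous_map (weak_topology smul) (weak_topology smul) (\<lambda>x. r *\<^sub>R x)"
    unfolding weak_topology_def
  proof (rule continuous_on_generated_topo)
    fix V assume "V \<in> ?B"
    then obtain f U where f: "f \<in> dual smul" "open U" "V = blinfun_apply f -` U" by blast
    have "(\<lambda>x. r *\<^sub>R x) -` V = blinfun_apply (r *\<^sub>R f) -` U"
      by (auto simp: f(3) blinfun.bilinear_simps)
    then have "(\<lambda>x. r *\<^sub>R x) -` V \<in> ?B" using f by blast
    then show "openin (topology_generated_by ?B)
        ((\<lambda>x. r *\<^sub>R x) -` V \<inter> topspace (topology_generated_by ?B))"
      unfolding topology_generated_by_topspace top by (simp add: topology_generated_by_Basis)
  qed (use top in simp)
  then show ?thesis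
    using assms image_compactin unfolding weakly_compact_def by blast
qed

text \<open>\<open>f\<close> is weakly continuous, since its preimages of open sets generate the
  weak topology; so the image of \<open>K\<close> is compact in the scalar field.\<close>

lemma weakly_compact_dual_bounded:
  fixes smul :: "'k::real_normed_field \<Rightarrow> 'a::banach \<Rightarrow> 'a"
  assumes K: "weakly_compact smul K" and f: "f \<in> dual smul"
  obtains C where "\<And>x. x \<in> K \<Longrightarrow> norm (f x) \<le> C"
proof -
  have "continuous_map (weak_topology smul) euclidean (blinfun_apply f)"
  proof (subst continuous_map, intro conjI allI impI)
    fix U :: "'k set" assume "openin euclidean U"
    then have "blinfun_apply f -` U \<in> {blinfun_apply f -` U |f U. f \<in> dual smul \<and> open U}"
      using f by auto
    then have op: "openin (weak_topology smul) (blinfun_apply f -` U)"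
      unfolding weak_topology_def by (rule topology_generated_by_Basis)
    have "{x \<in> topspace (weak_topology smul). f x \<in> U} = blinfun_apply f -` U"
      using openin_subset[OF op] by auto
    then show "openin (weak_topology smul) {x \<in> topspace (weak_topology smul). f x \<in> U}"
      using op by simp
  qed auto
  then have "compact (blinfun_apply f ` K)"
    using K image_compactin compactin_euclidean_iff unfolding weakly_compact_def by blast
  then obtain C where "\<forall>y\<in>blinfun_apply f ` K. norm y \<le> C"
    using compact_imp_bounded bounded_iff by metis
  then show ?thesis using that by blast
qed

subsection \<open>The quantity \<open>\<alpha>\<close> and Cesaro means\<close>

text \<open>The supremum over \<open>K\<close> stands inside the limsup, so a strict bound on
  \<open>alpha\<close> yields one threshold index serving all points of \<open>K\<close>.\<close>

lemma eventually_less_of_alpha_less: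
  fixes smul :: "'k::real_normed_field \<Rightarrow> 'a::banach \<Rightarrow> 'a" and h :: "nat \<Rightarrow> 'a \<Rightarrow>\<^sub>L 'k"
  assumes "alpha smul h < ennreal e" "weakly_compact smul K" "K \<subseteq> cball 0 1"
  shows "\<forall>\<^sub>F n in sequentially. \<forall>x\<in>K. norm (h n x) < e"
proof -
  let ?s = "\<lambda>n. SUP x\<in>K. ennreal (norm (h n x))"
  have "limsup ?s \<le> alpha smul h"
    unfolding alpha_def by (rule SUP_upper) (use assms in simp)
  then have "\<forall>\<^sub>F n in sequentially. ?s n < ennreal e"
    using assms(1) by (intro Limsup_lessD) simp
  then show ?thesis
  proof eventually_elim
    case (elim n)
    show ?case
    proof
      fix x assume "x \<in> K"
      then have "ennreal (norm (h n x)) \<le> ?s n" by (rule SUP_upper)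
      then have "ennreal (norm (h n x)) < ennreal e" using elim by (rule le_less_trans)
      then show "norm (h n x) < e" by (simp add: ennreal_less_iff)
    qed
  qed
qed

lemma alpha_eq_0:
  fixes smul :: "'k::real_normed_field \<Rightarrow> 'a::banach \<Rightarrow> 'a" and h :: "nat \<Rightarrow> 'a \<Rightarrow>\<^sub>L 'k"
  assumes "\<And>K e. weakly_compact smul K \<Longrightarrow> e > 0 \<Longrightarrow>
    \<forall>\<^sub>F n in sequentially. \<forall>x\<in>K. norm (h n x) < e"
  shows "alpha smul h = 0"
proof -
  have "limsup (\<lambda>n. SUP x\<in>K. ennreal (norm (h n x))) \<le> 0" if K: "weakly_compact smul K" for K
  proof (rule ennreal_le_epsilon)
    fix e :: real assume "e > 0"
    then have "\<forall>\<^sub>F n in sequentially. \<forall>x\<in>K. norm (h n x) < e" using assms K by blast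
    then have "\<forall>\<^sub>F n in sequentially. (SUP x\<in>K. ennreal (norm (h n x))) \<le> ennreal e"
      by eventually_elim (auto intro!: SUP_least ennreal_leI)
    then show "limsup (\<lambda>n. SUP x\<in>K. ennreal (norm (h n x))) \<le> 0 + ennreal e"
      by (simp add: Limsup_bounded)
  qed
  then have "alpha smul h \<le> 0"
    unfolding alpha_def by (intro SUP_least) auto
  then show ?thesis by simp
qed

lemma cesaro_scaleR: "cesaro (\<lambda>n. r *\<^sub>R f n) n = r *\<^sub>R cesaro f n"
  by (simp add: cesaro_def flip: scaleR_sum_right)

text \<open>The first \<open>m\<close> operators contribute at most \<open>m\<close> on the unit
  ball. With indices from 0, the mean at \<open>n + m\<close> has \<open>m\<close> leading and
  \<open>Suc n\<close> remaining terms; shrinking the denominator to \<open>Suc n\<close> only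
  enlarges the bound.\<close>

lemma norm_cesaro_shift:
  fixes h :: "nat \<Rightarrow> 'a::real_normed_vector \<Rightarrow>\<^sub>L 'b::real_normed_vector"
  assumes h: "\<And>i. norm (h i) \<le> 1" and x: "norm x \<le> 1"
  shows "norm (cesaro h (n + m) x) \<le> real m / real (Suc n) + norm (cesaro (\<lambda>i. h (i + m)) n x)"
proof -
  let ?S = "\<Sum>i<m. h i" and ?T = "\<Sum>i\<le>n. h (i + m)"
  have split: "(\<Sum>i\<le>n + m. h i) = ?S + ?T"
    by (induction n) (simp_all flip: lessThan_Suc_atMost)
  have "norm ?S \<le> (\<Sum>i<m. 1)"
    by (rule order_trans[OF norm_sum sum_mono]) (rule h)
  then have "norm ?S * norm x \<le> real m * 1"
    by (intro mult_mono) (use x in auto)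
  then have S: "norm (?S x) \<le> real m"
    using norm_blinfun[of ?S x] by linarith
  have "norm (cesaro h (n + m) x) = norm (?S x + ?T x) / real (Suc (n + m))"
    by (simp add: cesaro_def split blinfun.bilinear_simps divide_inverse mult.commute)
  also have "\<dots> \<le> (real m + norm (?T x)) / real (Suc (n + m))"
    using S norm_triangle_ineq[of "?S x" "?T x"] by (intro divide_right_mono) linarith+
  also have "\<dots> \<le> (real m + norm (?T x)) / real (Suc n)"
    by (intro divide_left_mono) auto
  also have "\<dots> = real m / real (Suc n) + norm (cesaro (\<lambda>i. h (i + m)) n x)"
    by (simp add: cesaro_def blinfun.bilinear_simps divide_inverse algebra_simps)
  finally show ?thesis .
qed

text \<open>The discarded terms cost at most \<open>m / (n + 1)\<close>, uniformly on
  \<open>K\<close>, and this eventually falls below the gap \<open>e - d\<close>.\<close>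

lemma eventually_cesaro_shift:
  fixes h :: "nat \<Rightarrow> 'a::real_normed_vector \<Rightarrow>\<^sub>L 'b::real_normed_vector"
  assumes h: "\<And>i. norm (h i) \<le> 1" and K: "K \<subseteq> cball 0 1" and "d < e"
    and ev: "\<forall>\<^sub>F n in sequentially. \<forall>x\<in>K. norm (cesaro (\<lambda>i. h (i + m)) n x) < d"
  shows "\<forall>\<^sub>F n in sequentially. \<forall>x\<in>K. norm (cesaro h n x) < e"
proof -
  have "(\<lambda>n. real m * inverse (real (Suc n))) \<longlonglongrightarrow> real m * 0"
    by (intro tendsto_intros LIMSEQ_inverse_real_of_nat)
  then have "\<forall>\<^sub>F n in sequentially. real m * inverse (real (Suc n)) < e - d"
    by (rule order_tendstoD) (use \<open>d < e\<close> in simp)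
  with ev have "\<forall>\<^sub>F n in sequentially. \<forall>x\<in>K. norm (cesaro h (n + m) x) < e"
  proof eventually_elim
    case (elim n)
    show ?case
    proof
      fix x assume "x \<in> K"
      then show "norm (cesaro h (n + m) x) < e"
        using norm_cesaro_shift[of h x n m] h K elim by (fastforce simp: divide_inverse)
    qed
  qed
  then show ?thesis by (rule iffD1[OF eventually_sequentially_seg])
qed

section \<open>Extraction of the diagonal subsequence\<close>

text \<open>An infimum equal to 0 need not be attained, so the subsequence is found for one fixed
  \<open>e\<close>; the inner supremum bounds all its further subsequences at once.\<close>

lemma mu_s_eq_0_imp_subsequence:
  assumes mu: "mu_s smul = 0" and f: "weak_star_null smul f" "\<And>n. norm (f n) \<le> 1" and "e > 0"
  obtains r :: "nat \<Rightarrow> nat" where "strict_mono r"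
    "\<And>t. strict_mono t \<Longrightarrow> c_alpha smul (f \<circ> r \<circ> t) < ennreal e"
proof -
  have "(INF g\<in>subsequences f. SUP h\<in>subsequences g. c_alpha smul h) \<le> mu_s smul"
    unfolding mu_s_def by (rule SUP_upper) (use f in simp)
  then have "(INF g\<in>subsequences f. SUP h\<in>subsequences g. c_alpha smul h) < ennreal e"
    using mu \<open>e > 0\<close> by simp
  then obtain g where g: "g \<in> subsequences f" "(SUP h\<in>subsequences g. c_alpha smul h) < ennreal e"
    by (auto simp: INF_less_iff)
  then obtain r where r: "strict_mono r" "g = f \<circ> r" by (auto simp: subsequences_def)
  show ?thesis
  proof (rule that[OF r(1)])
    fix t :: "nat \<Rightarrow> nat" assume "strict_mono t"
    then have "f \<circ> r \<circ> t \<in> subsequences g" by (auto simp: subsequences_def r)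
    then have "c_alpha smul (f \<circ> r \<circ> t) \<le> (SUP h\<in>subsequences g. c_alpha smul h)"
      by (rule SUP_upper)
    then show "c_alpha smul (f \<circ> r \<circ> t) < ennreal e" using g(2) by simp
  qed
qed

lemma mu_s_eq_0_imp_diagonal_subsequence:
  assumes mu: "mu_s smul = 0" and f: "weak_star_null smul f" "\<And>n. norm (f n) \<le> 1"
  obtains r :: "nat \<Rightarrow> nat" where "strict_mono r"
    "\<And>s K e. strict_mono s \<Longrightarrow> weakly_compact smul K \<Longrightarrow> K \<subseteq> cball 0 1 \<Longrightarrow> e > 0 \<Longrightarrow>
      \<forall>\<^sub>F n in sequentially. \<forall>x\<in>K. norm (cesaro (f \<circ> r \<circ> s) n x) < e"
proof -
  \<comment> \<open>Quantifying over all \<open>t\<close> makes \<open>P n\<close> pass to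
    subsequences, as the diagonal construction requires.\<close>
  define P where "P n r \<longleftrightarrow>
    (\<forall>t. strict_mono t \<longrightarrow> c_alpha smul (f \<circ> r \<circ> t) < ennreal (inverse (real (Suc n))))"
    for n :: nat and r :: "nat \<Rightarrow> nat"
  interpret subseqs P
  proof
    fix n :: nat and s :: "nat \<Rightarrow> nat" assume s: "strict_mono s"
    have fs: "norm ((f \<circ> s) i) \<le> 1" for i using f(2) by simp
    have pos: "inverse (real (Suc n)) > 0" by simp
    obtain r :: "nat \<Rightarrow> nat" where "strict_mono r" "\<And>t. strict_mono t \<Longrightarrow>
        c_alpha smul ((f \<circ> s) \<circ> r \<circ> t) < ennreal (inverse (real (Suc n)))"
      using mu_s_eq_0_imp_subsequence[OF mu weak_star_null_subseq[OF f(1) s] fs pos] by blast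
    then show "\<exists>r. strict_mono r \<and> P n (s \<circ> r)"
      by (auto simp: P_def o_assoc)
  qed
  have P: "P k (diagseq \<circ> (+) (Suc k))" for k
    by (rule diagseq_holds) (auto simp: P_def o_assoc[symmetric] intro: strict_mono_o)
  show ?thesis
  proof (rule that[OF subseq_diagseq])
    fix s :: "nat \<Rightarrow> nat" and K and e :: real
    assume s: "strict_mono s" and K: "weakly_compact smul K" "K \<subseteq> cball 0 1" and "e > 0"
    obtain k where k: "inverse (real (Suc k)) < e"
      using reals_Archimedean[OF \<open>e > 0\<close>] by blast
    \<comment> \<open>As \<open>s j \<ge> j\<close>, the terms of
      \<open>f \<circ> diagseq \<circ> s\<close> from index \<open>Suc k\<close> on lie in the tail
      of the diagonal sequence governed by \<open>P k\<close>; \<open>t\<close> gives their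
      positions within that tail.\<close>
    define t where "t i = s (i + Suc k) - Suc k" for i
    have ge: "s (i + Suc k) \<ge> Suc k" for i
      using seq_suble[OF s, of "i + Suc k"] by simp
    have "strict_mono t"
      using s ge by (auto simp: strict_mono_def t_def intro!: diff_less_mono)
    then have "c_alpha smul (f \<circ> (diagseq \<circ> (+) (Suc k)) \<circ> t) < ennreal (inverse (real (Suc k)))"
      using P by (simp add: P_def)
    moreover have "f \<circ> (diagseq \<circ> (+) (Suc k)) \<circ> t = (\<lambda>i. (f \<circ> diagseq \<circ> s) (i + Suc k))"
    proof
      show "(f \<circ> (diagseq \<circ> (+) (Suc k)) \<circ> t) i = (f \<circ> diagseq \<circ> s) (i + Suc k)" for i
        using le_add_diff_inverse[OF ge[of i]] by (simp add: t_def)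
    qed
    ultimately have "\<forall>\<^sub>F n in sequentially. \<forall>x\<in>K.
        norm (cesaro (\<lambda>i. (f \<circ> diagseq \<circ> s) (i + Suc k)) n x) < inverse (real (Suc k))"
      unfolding c_alpha_def using K by (intro eventually_less_of_alpha_less) auto
    then show "\<forall>\<^sub>F n in sequentially. \<forall>x\<in>K. norm (cesaro (f \<circ> diagseq \<circ> s) n x) < e"
      by (rule eventually_cesaro_shift[OF _ K(2) k, rotated]) (simp add: f(2))
  qed
qed

subsection \<open>Property \<open>(\<mu>\<^sup>s)\<close>\<close>

text \<open>The subsequence supplied by the property makes every \<open>c_alpha\<close> in the inner
  supremum vanish, so each infimum is 0.\<close>

lemma property_mu_s_imp_mu_s_eq_0:
  assumes "property_mu_s smul"
  shows "mu_s smul = 0"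
proof -
  have "(INF g\<in>subsequences f. SUP h\<in>subsequences g. c_alpha smul h) \<le> 0"
    if f: "weak_star_null smul f" for f
  proof -
    obtain g where g: "g \<in> subsequences f" "\<And>h. h \<in> subsequences g \<Longrightarrow>
        limitin (mackey_topology smul) (cesaro h) 0 sequentially"
      using assms f unfolding property_mu_s_def by blast
    have "c_alpha smul h = 0" if h: "h \<in> subsequences g" for h
    proof -
      have "h n \<in> dual smul" for n
        using f g(1) h by (auto simp: subsequences_def weak_star_null_def)
      then show ?thesis
        unfolding c_alpha_def using g(2)[OF h]
        by (intro alpha_eq_0) (auto simp: limitin_mackey_topology_0_iff dual_cesaro)
    qed
    then have "(SUP h\<in>subsequences g. c_alpha smul h) \<le> 0"
      by (intro SUP_least) simp
    then show ?thesis using g(1) by (rule INF_lower2[rotated])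
  qed
  then have "mu_s smul \<le> 0"
    unfolding mu_s_def by (intro SUP_least) auto
  then show ?thesis by simp
qed

text \<open>The second hypothesis is how real norming functionals are transferred to the dual over
  \<open>'k\<close>: over the complex numbers a real functional is the real part of a complex one.\<close>

lemma mu_s_eq_0_imp_property_mu_s:
  fixes smul :: "'k::real_normed_field \<Rightarrow> 'a::banach \<Rightarrow> 'a"
  assumes "banach_space_over smul"
    and dom: "\<And>u :: 'a \<Rightarrow>\<^sub>L real. \<exists>f\<in>dual smul. \<forall>x. \<bar>u x\<bar> \<le> norm (f x)"
    and mu: "mu_s smul = 0"
  shows "property_mu_s smul"
  unfolding property_mu_s_def
proof (intro allI impI)
  interpret banach_space_over smul by fact
  fix f assume f: "weak_star_null smul f"
  obtain M where M: "M > 0" "\<And>n. norm (f n) \<le> M"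
    using weak_star_null_bounded[OF f] by blast
  define F where "F n = (1 / M) *\<^sub>R f n" for n
  have Fw: "weak_star_null smul F"
    unfolding F_def[abs_def] using f by (rule weak_star_null_scaleR)
  have Fn: "norm (F n) \<le> 1" for n
    using M by (simp add: F_def divide_le_eq)
  obtain r :: "nat \<Rightarrow> nat" where r: "strict_mono r"
      "\<And>s K e. strict_mono s \<Longrightarrow> weakly_compact smul K \<Longrightarrow> K \<subseteq> cball 0 1 \<Longrightarrow> e > 0 \<Longrightarrow>
        \<forall>\<^sub>F n in sequentially. \<forall>x\<in>K. norm (cesaro (F \<circ> r \<circ> s) n x) < e"
    using mu_s_eq_0_imp_diagonal_subsequence[OF mu Fw Fn] by blast
  have "limitin (mackey_topology smul) (cesaro (f \<circ> r \<circ> s)) 0 sequentially"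
    if s: "strict_mono s" for s
  proof (subst limitin_mackey_topology_0_iff, goal_cases)
    case (1 n)
    then show ?case using f by (intro dual_cesaro) (auto simp: weak_star_null_def)
  next
    case 2
    show ?case
    proof (intro allI impI)
      fix K and e :: real
      assume K: "weakly_compact smul K" and e: "e > 0"
      \<comment> \<open>Weak compactness controls functionals in the dual over \<open>'k\<close>;
        domination carries the bound over to every real functional.\<close>
      have "\<exists>C. \<forall>x\<in>K. \<bar>u x\<bar> \<le> C" for u :: "'a \<Rightarrow>\<^sub>L real"
      proof -
        obtain g where g: "g \<in> dual smul" "\<forall>x. \<bar>u x\<bar> \<le> norm (g x)" using dom by blast
        then show ?thesis using weakly_compact_dual_bounded[OF K g(1)] by (metis order_trans)
      qed
      then obtain C where C: "C > 0" "\<And>x. x \<in> K \<Longrightarrow> norm x \<le> C"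
        using weakly_bounded_imp_bounded by metis
      \<comment> \<open>Dividing by \<open>C\<close> puts \<open>K\<close> into the unit ball; the
        threshold \<open>e / (C * M)\<close> compensates for this and for the factor
        \<open>1 / M\<close> in \<open>F\<close>.\<close>
      have "\<forall>\<^sub>F n in sequentially. \<forall>x\<in>(\<lambda>x. (1 / C) *\<^sub>R x) ` K.
          norm (cesaro (F \<circ> r \<circ> s) n x) < e / (C * M)"
        by (rule r(2)[OF s weakly_compact_scaleR[OF K]])
          (use C M e in \<open>auto simp: divide_le_eq\<close>)
      then show "\<forall>\<^sub>F n in sequentially. \<forall>x\<in>K. norm (cesaro (f \<circ> r \<circ> s) n x) < e"
      proof eventually_elim
        case (elim n)
        have ces: "cesaro (F \<circ> r \<circ> s) n = (1 / M) *\<^sub>R cesaro (f \<circ> r \<circ> s) n"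
          unfolding cesaro_scaleR[symmetric] by (simp add: F_def o_def)
        show ?case
          using elim C(1) M(1) by (auto simp: ces blinfun.bilinear_simps field_simps)
      qed
    qed
  qed
  then show "\<exists>g\<in>subsequences f. \<forall>h\<in>subsequences g.
      limitin (mackey_topology smul) (cesaro h) 0 sequentially"
    using r(1) by (intro bexI[of _ "f \<circ> r"]) (auto simp: subsequences_def)
qed

text \<open>By \<open>smul_of_real\<close> the scalar multiplication is \<open>scaleR\<close>, so
  \<open>u\<close> itself lies in the dual.\<close>

lemma real_functional_dominated_real:
  fixes smul :: "real \<Rightarrow> 'a::banach \<Rightarrow> 'a" and u :: "'a \<Rightarrow>\<^sub>L real"
  assumes "banach_space_over smul"
  shows "\<exists>f\<in>dual smul. \<forall>x. \<bar>u x\<bar> \<le> norm (f x)"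
proof -
  interpret banach_space_over smul by fact
  have "u \<in> dual smul"
    using smul_of_real by (simp add: dual_def blinfun.bilinear_simps)
  then show ?thesis by force
qed

text \<open>The standard complexification \<open>u x - \<i> * u (smul \<i> x)\<close> is complex
  linear with real part \<open>u\<close>, and a modulus dominates the real part.\<close>

lemma real_functional_dominated_complex:
  fixes smul :: "complex \<Rightarrow> 'a::banach \<Rightarrow> 'a" and u :: "'a \<Rightarrow>\<^sub>L real"
  assumes "banach_space_over smul"
  shows "\<exists>f\<in>dual smul. \<forall>x. \<bar>u x\<bar> \<le> norm (f x)"
proof -
  interpret banach_space_over smul by fact
  define F where "F x = Complex (u x) (- u (smul \<i> x))" for x
  have bl: "bounded_linear F"
  proof (rule bounded_linear_intro)
    show "F (x + y) = F x + F y" for x y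
      by (simp add: F_def scale_right_distrib blinfun.bilinear_simps complex_eq_iff)
    have "smul \<i> (r *\<^sub>R x) = r *\<^sub>R smul \<i> x" for r x
      by (simp add: mult.commute flip: smul_of_real)
    then show "F (r *\<^sub>R x) = r *\<^sub>R F x" for r x
      by (simp add: F_def blinfun.bilinear_simps complex_eq_iff)
    show "norm (F x) \<le> norm x * (2 * norm u)" for x
    proof -
      have "norm (F x) \<le> \<bar>u x\<bar> + \<bar>u (smul \<i> x)\<bar>"
        using cmod_le[of "F x"] by (simp add: F_def)
      then show ?thesis
        using norm_blinfun[of u x] norm_blinfun[of u "smul \<i> x"] by (simp add: norm_smul mult.commute)
    qed
  qed
  have "F (smul c x) = c * F x" for c x
  proof -
    \<comment> \<open>Splitting \<open>c\<close> turns \<open>smul c x\<close> and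
      \<open>smul \<i> (smul c x)\<close> into real combinations of \<open>x\<close> and
      \<open>smul \<i> x\<close>, where real linearity of \<open>u\<close> suffices.\<close>
    have c: "c = of_real (Re c) + of_real (Im c) * \<i>" "\<i> * c = of_real (Re c) * \<i> - of_real (Im c)"
      by (simp_all add: complex_eq_iff)
    have "smul c x = Re c *\<^sub>R x + Im c *\<^sub>R smul \<i> x"
      by (subst c(1)) (simp add: scale_left_distrib flip: smul_of_real)
    moreover have "smul \<i> (smul c x) = Re c *\<^sub>R smul \<i> x - Im c *\<^sub>R x"
      by (simp add: c(2) scale_left_diff_distrib flip: smul_of_real)
    ultimately show ?thesis
      by (simp add: F_def blinfun.bilinear_simps complex_eq_iff)
  qed
  then have "Blinfun F \<in> dual smul"
    by (simp add: dual_def bounded_linear_Blinfun_apply[OF bl])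
  moreover have "\<bar>u x\<bar> \<le> norm (Blinfun F x)" for x
    using abs_Re_le_cmod[of "F x"] by (simp add: bounded_linear_Blinfun_apply[OF bl] F_def)
  ultimately show ?thesis by blast
qed

theorem theorem5p2:
  fixes rsmul :: "real \<Rightarrow> 'a::banach \<Rightarrow> 'a"
    and csmul :: "complex \<Rightarrow> 'b::banach \<Rightarrow> 'b"
  shows "(banach_space_over rsmul \<and> infinite_dimensional rsmul \<longrightarrow>
            (property_mu_s rsmul \<longleftrightarrow> mu_s rsmul = 0)) \<and>
         (banach_space_over csmul \<and> infinite_dimensional csmul \<longrightarrow>
            (property_mu_s csmul \<longleftrightarrow> mu_s csmul = 0))"
  using property_mu_s_imp_mu_s_eq_0[of rsmul] property_mu_s_imp_mu_s_eq_0[of csmul]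
    mu_s_eq_0_imp_property_mu_s[OF _ real_functional_dominated_real, of rsmul]
    mu_s_eq_0_imp_property_mu_s[OF _ real_functional_dominated_complex, of csmul]
  by blast

end
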